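(* Let $(m_{k})_{k\ge 0}$ and $(n_{k'})_{k'\ge 0}$ be two strictly increasing sequences of integers. Let $\psi:\mathbb{N}\to\mathbb{N}$ be such that $\psi(k)\to+\infty$ as $k\to+\infty$, and set $$D_{\psi}=\{(k,k')\in\mathbb{N}^{2} : 0\le k'\le\psi(k)\}.$$ Suppose that the set $$C'_{\psi}=\{\lambda\in\mathbb{T} : \lambda^{m_{k}n_{k'}}\to 1 \text{ as } k\to+\infty,\ (k,k')\in D_{\psi}\}$$ is dense in $\mathbb{T}$. Then for every $\varepsilon>0$ there exists a continuous Borel probability measure $\mu$ on $\mathbb{T}$ such that $\widehat{\mu}(m_{k}n_{k'})\to 1$ as $k\to+\infty$ with $(k,k')\in D_{\psi}$ and $$\sup_{k\ge 0,\ 0\le k'\le\psi(k)}|\widehat{\mu}(m_{k}n_{k'})-1|<\varepsilon.$$ In particular, $\{m_{k}n_{k'} : k\ge 0,\ 0\le k'\le\psi(k)\}$ is a non-Kazhdan subset of $\mathbb{Z}$ (that is, it is not a Kazhdan subset of $\mathbb{Z}$).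
   Context: $\mathbb{N}$ denotes the nonnegative integers and $\mathbb{T}=\{\lambda\in\mathbb{C} : |\lambda|=1\}$. For a finite complex Borel measure $\mu$ on $\mathbb{T}$ and $n\in\mathbb{Z}$, $\widehat{\mu}(n)=\int_{\mathbb{T}}\lambda^{n}\,d\mu(\lambda)$. A Borel probability measure $\mu$ on $\mathbb{T}$ is continuous if $\mu(\{\lambda\})=0$ for every $\lambda\in\mathbb{T}$. For a doubly indexed family $(z_{k,k'})_{k,k'\ge 0}$ of complex numbers, "$z_{k,k'}\to z$ as $k\to+\infty$ with $(k,k')\in D_{\psi}$" means: for every $\gamma>0$ there is an integer $k_{0}$ such that $|z_{k,k'}-z|<\gamma$ for every $(k,k')\in\mathbb{N}^2$ with $k\ge k_{0}$ and $0\le k'\le\psi(k)$. A subset $Q\subseteq\mathbb{Z}$ is a Kazhdan subset of $\mathbb{Z}$ if there exists $\varepsilon>0$ such that every unitary operator $U$ acting on a complex separable Hilbert space $H$ has the following property: if there is $x\in H$ with $\|x\|=1$ and $\sup_{n\in Q}\|U^{n}x-x\|<\varepsilon$, then there is a non-zero $y\in H$ with $Uy=y$. *)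

theory Defs
  imports
    "HOL-Probability.Probability_Measure"
    "HOL-Analysis.Abstract_Metric_Spaces"
    "HOL-Algebra.Module"
begin

section \<open>Measures on the unit circle\<close>

abbreviation unit_circle :: "complex set" where
  "unit_circle \<equiv> sphere 0 1"

definition circle_probability :: "complex measure \<Rightarrow> bool" where
  "circle_probability \<mu> \<longleftrightarrow>
     prob_space \<mu> \<and> sets \<mu> = sets (restrict_space borel unit_circle)"

definition continuous_measure :: "complex measure \<Rightarrow> bool" where
  "continuous_measure \<mu> \<longleftrightarrow> (\<forall>z\<in>unit_circle. measure \<mu> {z} = 0)"

definition fourier_coeff :: "complex measure \<Rightarrow> int \<Rightarrow> complex" where
  "fourier_coeff \<mu> n = (\<integral>z. z powi n \<partial>\<mu>)"

section \<open>Doubly indexed families\<close>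

definition D_set :: "(nat \<Rightarrow> nat) \<Rightarrow> (nat \<times> nat) set" where
  "D_set \<psi> = {(k, k'). 0 \<le> k' \<and> k' \<le> \<psi> k}"

text \<open>Only \<open>k\<close> tends to infinity; the convergence is uniform in \<open>k' \<le> \<psi> k\<close>.\<close>

definition tendsto_along :: "(nat \<Rightarrow> nat) \<Rightarrow> (nat \<Rightarrow> nat \<Rightarrow> complex) \<Rightarrow> complex \<Rightarrow> bool" where
  "tendsto_along \<psi> z l \<longleftrightarrow>
     (\<forall>\<gamma>>0. \<exists>k0. \<forall>(k, k') \<in> D_set \<psi>. k \<ge> k0 \<longrightarrow> cmod (z k k' - l) < \<gamma>)"

definition C_set :: "(nat \<Rightarrow> int) \<Rightarrow> (nat \<Rightarrow> int) \<Rightarrow> (nat \<Rightarrow> nat) \<Rightarrow> complex set" where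
  "C_set m n \<psi> = {z \<in> unit_circle. tendsto_along \<psi> (\<lambda>k k'. z powi (m k * n k')) 1}"

section \<open>Complex separable Hilbert spaces\<close>

definition complex_ring :: "complex ring" where
  "complex_ring = \<lparr>carrier = UNIV, mult = (*), one = 1, zero = 0, add = (+)\<rparr>"

text \<open>The fields \<open>mult\<close> and \<open>one\<close> that a module record inherits from rings play no role.\<close>

record 'a inner_module = "(complex, 'a) module" +
  ip :: "'a \<Rightarrow> 'a \<Rightarrow> complex"

definition hnorm :: "('a, 'm) inner_module_scheme \<Rightarrow> 'a \<Rightarrow> real" where
  "hnorm H x = sqrt (Re (ip H x x))"

text \<open>\<open>Metric_space\<close> wants nonnegativity and symmetry on the whole type, hence the default value
  outside the carrier.\<close>

definition hdist :: "('a, 'm) inner_module_scheme \<Rightarrow> 'a \<Rightarrow> 'a \<Rightarrow> real" where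
  "hdist H x y = (if x \<in> carrier H \<and> y \<in> carrier H then hnorm H (x \<ominus>\<^bsub>H\<^esub> y) else 0)"

locale complex_inner_space = module complex_ring H
  for H :: "('a, 'm) inner_module_scheme" (structure) +
  assumes ip_add_left: "\<lbrakk>x \<in> carrier H; y \<in> carrier H; z \<in> carrier H\<rbrakk>
            \<Longrightarrow> ip H (x \<oplus> y) z = ip H x z + ip H y z"
    and ip_smult_left: "\<lbrakk>x \<in> carrier H; y \<in> carrier H\<rbrakk> \<Longrightarrow> ip H (a \<odot> x) y = a * ip H x y"
    and ip_commute: "\<lbrakk>x \<in> carrier H; y \<in> carrier H\<rbrakk> \<Longrightarrow> ip H y x = cnj (ip H x y)"
    and ip_nonneg: "x \<in> carrier H \<Longrightarrow> 0 \<le> Re (ip H x x)"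
    and ip_eq_zero: "\<lbrakk>x \<in> carrier H; ip H x x = 0\<rbrakk> \<Longrightarrow> x = \<zero>"

lemma cring_complex_ring: "cring complex_ring"
proof (rule cringI)
  show "abelian_group complex_ring"
    by (rule abelian_groupI) (auto simp: complex_ring_def intro: exI[of _ "- _"] simp: add_eq_0_iff)
  show "Group.comm_monoid complex_ring"
    by (rule comm_monoidI) (auto simp: complex_ring_def)
qed (auto simp: complex_ring_def algebra_simps)

context complex_inner_space
begin

lemma carrier_scalar [simp]: "a \<in> carrier complex_ring"
  by (simp add: complex_ring_def)

lemma ip_add_right:
  "\<lbrakk>x \<in> carrier H; y \<in> carrier H; z \<in> carrier H\<rbrakk> \<Longrightarrow> ip H z (x \<oplus> y) = ip H z x + ip H z y"
  by (metis M.add.m_closed complex_cnj_add ip_add_left ip_commute)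

lemma ip_smult_right:
  "\<lbrakk>x \<in> carrier H; y \<in> carrier H\<rbrakk> \<Longrightarrow> ip H x (a \<odot> y) = cnj a * ip H x y"
  by (metis carrier_scalar complex_cnj_mult ip_commute ip_smult_left smult_closed)

lemma minus_eq_smult: "x \<in> carrier H \<Longrightarrow> \<ominus> x = (- 1) \<odot> x"
proof -
  assume x: "x \<in> carrier H"
  have "((- 1) + 1) \<odot> x = (- 1) \<odot> x \<oplus> 1 \<odot> x"
    using smult_l_distr[of "- 1" 1 x] x by (simp add: complex_ring_def)
  moreover have "1 \<odot> x = x" using smult_one[OF x] by (simp add: complex_ring_def)
  moreover have "0 \<odot> x = \<zero>" using smult_l_null[OF x] by (simp add: complex_ring_def)
  ultimately have "(- 1) \<odot> x \<oplus> x = \<zero>" by simp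
  then show ?thesis using x M.minus_equality by auto
qed

lemma ip_self: "x \<in> carrier H \<Longrightarrow> ip H x x = of_real (Re (ip H x x))"
  by (metis Reals_cnj_iff ip_commute of_real_Re)

lemma ip_zero [simp]: "x \<in> carrier H \<Longrightarrow> ip H \<zero> x = 0" "x \<in> carrier H \<Longrightarrow> ip H x \<zero> = 0"
  using ip_add_left[of \<zero> \<zero> x] ip_add_right[of \<zero> \<zero> x] by simp_all

lemma hnorm_nonneg: "x \<in> carrier H \<Longrightarrow> 0 \<le> hnorm H x"
  by (simp add: hnorm_def ip_nonneg)

lemma hnorm_power2: "x \<in> carrier H \<Longrightarrow> (hnorm H x)\<^sup>2 = Re (ip H x x)"
  by (simp add: hnorm_def ip_nonneg)

lemma hnorm_eq_0_iff: "x \<in> carrier H \<Longrightarrow> hnorm H x = 0 \<longleftrightarrow> x = \<zero>"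
  by (metis hnorm_def ip_eq_zero ip_self ip_zero(1) M.zero_closed of_real_0 real_sqrt_eq_zero_cancel_iff zero_complex.sel(1))

lemma Cauchy_Schwarz_Re:
  assumes x: "x \<in> carrier H" and y: "y \<in> carrier H"
  shows "Re (ip H x y) \<le> hnorm H x * hnorm H y"
proof -
  define a b where "a = hnorm H x" and "b = hnorm H y"
  have ab: "a \<ge> 0" "b \<ge> 0" using x y hnorm_nonneg by (auto simp: a_def b_def)
  have Rc: "Re (ip H y x) = Re (ip H x y)" using ip_commute[OF x y] by simp
  define s t where "s = complex_of_real b" and "t = complex_of_real (- a)"
  have c: "s \<odot> x \<in> carrier H" "t \<odot> y \<in> carrier H" using x y by auto
  have "0 \<le> Re (ip H (s \<odot> x \<oplus> t \<odot> y) (s \<odot> x \<oplus> t \<odot> y))"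
    using c by (intro ip_nonneg) auto
  also have "\<dots> = b\<^sup>2 * Re (ip H x x) - 2 * a * b * Re (ip H x y) + a\<^sup>2 * Re (ip H y y)"
    using x y c Rc
    by (simp add: ip_add_left ip_add_right ip_smult_left ip_smult_right s_def t_def
        algebra_simps power2_eq_square)
  also have "\<dots> = 2 * (a * b) * (a * b - Re (ip H x y))"
    using x y by (simp add: hnorm_power2[symmetric] a_def b_def algebra_simps power2_eq_square)
  finally have *: "0 \<le> 2 * (a * b) * (a * b - Re (ip H x y))" .
  show ?thesis
  proof (cases "a * b = 0")
    case True
    then have "x = \<zero> \<or> y = \<zero>" using hnorm_eq_0_iff x y by (auto simp: a_def b_def)
    then show ?thesis using x y hnorm_nonneg by (auto simp: hnorm_nonneg)
  next
    case False
    then have "a * b > 0" using ab by (simp add: less_le)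
    then show ?thesis using * by (auto simp: a_def b_def zero_le_mult_iff)
  qed
qed

lemma hnorm_triangle:
  assumes x: "x \<in> carrier H" and y: "y \<in> carrier H"
  shows "hnorm H (x \<oplus> y) \<le> hnorm H x + hnorm H y"
proof (rule power2_le_imp_le)
  have Rc: "Re (ip H y x) = Re (ip H x y)" using ip_commute[OF x y] by simp
  have "(hnorm H (x \<oplus> y))\<^sup>2 = (hnorm H x)\<^sup>2 + 2 * Re (ip H x y) + (hnorm H y)\<^sup>2"
    using x y Rc by (simp add: hnorm_power2 ip_add_left ip_add_right)
  then show "(hnorm H (x \<oplus> y))\<^sup>2 \<le> (hnorm H x + hnorm H y)\<^sup>2"
    using Cauchy_Schwarz_Re[OF x y] by (simp add: power2_sum)
qed (use x y hnorm_nonneg in auto)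

lemma hnorm_minus: "x \<in> carrier H \<Longrightarrow> hnorm H (\<ominus> x) = hnorm H x"
  by (simp add: hnorm_def minus_eq_smult ip_smult_left ip_smult_right)

lemma Metric_space_hdist: "Metric_space (carrier H) (hdist H)"
proof
  show "0 \<le> hdist H x y" for x y by (simp add: hdist_def hnorm_nonneg)
  show "hdist H x y = hdist H y x" for x y
    using hnorm_minus[of "x \<ominus> y"] by (auto simp: hdist_def M.minus_add M.a_comm a_minus_def)
  show "hdist H x y = 0 \<longleftrightarrow> x = y" if "x \<in> carrier H" "y \<in> carrier H" for x y
    using that by (simp add: hdist_def hnorm_eq_0_iff)
      (metis M.add.inv_solve_right' M.l_zero M.zero_closed a_minus_def)
  show "hdist H x z \<le> hdist H x y + hdist H y z"
    if "x \<in> carrier H" "y \<in> carrier H" "z \<in> carrier H" for x y z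
  proof -
    have "x \<ominus> z = (x \<ominus> y) \<oplus> (y \<ominus> z)"
      using that by (simp add: a_minus_def M.a_assoc M.r_neg1)
    then show ?thesis using that hnorm_triangle[of "x \<ominus> y" "y \<ominus> z"] by (simp add: hdist_def)
  qed
qed

end

locale separable_hilbert_space = complex_inner_space +
  assumes complete: "Metric_space.mcomplete (carrier H) (hdist H)"
    and separable: "separable_space (Metric_space.mtopology (carrier H) (hdist H))"

definition unitary_op :: "('a, 'm) inner_module_scheme \<Rightarrow> ('a \<Rightarrow> 'a) \<Rightarrow> bool" where
  "unitary_op H U \<longleftrightarrow>
     U ` carrier H = carrier H \<and>
     (\<forall>x\<in>carrier H. \<forall>y\<in>carrier H. U (x \<oplus>\<^bsub>H\<^esub> y) = U x \<oplus>\<^bsub>H\<^esub> U y) \<and>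
     (\<forall>a. \<forall>x\<in>carrier H. U (a \<odot>\<^bsub>H\<^esub> x) = a \<odot>\<^bsub>H\<^esub> U x) \<and>
     (\<forall>x\<in>carrier H. \<forall>y\<in>carrier H. ip H (U x) (U y) = ip H x y)"

definition op_powi :: "('a, 'm) inner_module_scheme \<Rightarrow> ('a \<Rightarrow> 'a) \<Rightarrow> int \<Rightarrow> 'a \<Rightarrow> 'a" where
  "op_powi H U n =
     (if n \<ge> 0 then U ^^ nat n else inv_into (carrier H) U ^^ nat (- n))"

section \<open>Kazhdan subsets of the integers\<close>

text \<open>The supremum is taken in the extended reals, where it exists for every \<open>Q\<close>;
  for \<open>Q = {}\<close> the condition on \<open>x\<close> reduces to \<open>hnorm H x = 1\<close>.\<close>

definition kazhdan_property ::
  "('a, 'm) inner_module_scheme \<Rightarrow> int set \<Rightarrow> real \<Rightarrow> bool" where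
  "kazhdan_property H Q \<epsilon> \<longleftrightarrow>
     (\<forall>U. unitary_op H U \<longrightarrow>
        (\<exists>x\<in>carrier H. hnorm H x = 1 \<and>
           (SUP n\<in>Q. ereal (hdist H (op_powi H U n x) x)) < ereal \<epsilon>) \<longrightarrow>
        (\<exists>y\<in>carrier H. y \<noteq> \<zero>\<^bsub>H\<^esub> \<and> U y = y))"

text \<open>A definition cannot quantify over types, so the spaces are structures carried by
  arbitrary subsets of one type with the cardinality of the continuum. Nothing is lost: a
  separable metric space has at most that many points, and \<open>kazhdan_property_any_type\<close> below
  shows that a constant \<open>\<epsilon>\<close> for these spaces works for separable Hilbert spaces over
  any type.\<close>

definition kazhdan_subset :: "int set \<Rightarrow> bool" where
  "kazhdan_subset Q \<longleftrightarrow>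
     (\<exists>\<epsilon>>0. \<forall>H :: (nat \<Rightarrow> complex) inner_module.
        separable_hilbert_space H \<longrightarrow> kazhdan_property H Q \<epsilon>)"

definition transport :: "('a \<Rightarrow> 'b) \<Rightarrow> 'a inner_module \<Rightarrow> 'b inner_module" where
  "transport f G = (let g = inv_into (carrier G) f in
     \<lparr>carrier = f ` carrier G, mult = (\<lambda>x y. undefined), one = undefined,
      zero = f \<zero>\<^bsub>G\<^esub>, add = (\<lambda>x y. f (g x \<oplus>\<^bsub>G\<^esub> g y)),
      smult = (\<lambda>a x. f (a \<odot>\<^bsub>G\<^esub> g x)), ip = (\<lambda>x y. ip G (g x) (g y))\<rparr>)"

locale inner_space_transport = G: separable_hilbert_space G
  for G :: "'a inner_module" and f :: "'a \<Rightarrow> 'b" and T :: "'b inner_module" +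
  assumes inj: "inj_on f (carrier G)" and T_def: "T = transport f G"
begin

lemma T_simps [simp]:
  "carrier T = f ` carrier G" "\<zero>\<^bsub>T\<^esub> = f \<zero>\<^bsub>G\<^esub>"
  "\<lbrakk>x \<in> carrier G; y \<in> carrier G\<rbrakk> \<Longrightarrow> f x \<oplus>\<^bsub>T\<^esub> f y = f (x \<oplus>\<^bsub>G\<^esub> y)"
  "x \<in> carrier G \<Longrightarrow> a \<odot>\<^bsub>T\<^esub> f x = f (a \<odot>\<^bsub>G\<^esub> x)"
  "\<lbrakk>x \<in> carrier G; y \<in> carrier G\<rbrakk> \<Longrightarrow> ip T (f x) (f y) = ip G x y"
  using inj by (simp_all add: T_def transport_def Let_def)

lemma abelian_group_T: "abelian_group T"
proof (rule abelian_groupI)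
  fix x assume "x \<in> carrier T"
  then obtain u where u: "u \<in> carrier G" "x = f u" by auto
  then show "\<exists>y\<in>carrier T. y \<oplus>\<^bsub>T\<^esub> x = \<zero>\<^bsub>T\<^esub>"
    by (intro bexI[of _ "f (\<ominus>\<^bsub>G\<^esub> u)"]) (auto simp: G.M.l_neg)
qed (auto simp: G.M.a_ac)

lemma inner_T: "complex_inner_space T"
proof -
  interpret T: abelian_group T by (rule abelian_group_T)
  have "module complex_ring T"
    by (rule moduleI)
       (auto simp: cring_complex_ring abelian_group_T G.smult_l_distr G.smult_r_distr G.smult_assoc1)
  then show ?thesis
    unfolding complex_inner_space_def complex_inner_space_axioms_def
    by (auto simp: G.ip_add_left G.ip_smult_left G.ip_nonneg intro: G.ip_commute dest: G.ip_eq_zero)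
qed

lemma hnorm_T: "x \<in> carrier G \<Longrightarrow> hnorm T (f x) = hnorm G x"
  by (simp add: hnorm_def)

lemma hdist_T: "\<lbrakk>x \<in> carrier G; y \<in> carrier G\<rbrakk> \<Longrightarrow> hdist T (f x) (f y) = hdist G x y"
proof -
  assume xy: "x \<in> carrier G" "y \<in> carrier G"
  interpret T: abelian_group T by (rule abelian_group_T)
  have "\<ominus>\<^bsub>T\<^esub> (f y) = f (\<ominus>\<^bsub>G\<^esub> y)"
    using xy by (intro T.minus_equality) (auto simp: G.M.l_neg)
  then show ?thesis using xy by (simp add: hdist_def a_minus_def hnorm_T)
qed

sublocale MM: Metric_space12 "carrier G" "hdist G" "carrier T" "hdist T"
  unfolding Metric_space12_def
  using G.Metric_space_hdist complex_inner_space.Metric_space_hdist[OF inner_T] by blast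

lemma homeo_T: "homeomorphic_map MM.M1.mtopology MM.M2.mtopology f"
  by (rule MM.isometry_imp_homeomorphic_map) (auto simp: hdist_T)

lemma complete_T: "MM.M2.mcomplete"
  unfolding MM.M2.mcomplete_def
proof (intro allI impI)
  fix \<sigma> assume \<sigma>: "MM.M2.MCauchy \<sigma>"
  then have "\<forall>n. \<exists>x\<in>carrier G. \<sigma> n = f x"
    unfolding MM.M2.MCauchy_def by (auto simp: image_subset_iff image_iff)
  then obtain \<tau> where \<tau>: "\<And>n. \<tau> n \<in> carrier G" "\<And>n. \<sigma> n = f (\<tau> n)" by metis
  have "MM.M1.MCauchy \<tau>"
    using \<sigma> \<tau> unfolding MM.M2.MCauchy_def MM.M1.MCauchy_def by (auto simp: hdist_T)
  then obtain x where x: "limitin MM.M1.mtopology \<tau> x sequentially"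
    using G.complete by (auto simp: MM.M1.mcomplete_def)
  have "limitin MM.M2.mtopology (f \<circ> \<tau>) (f x) sequentially"
    by (rule continuous_map_limit[OF homeomorphic_imp_continuous_map[OF homeo_T] x])
  moreover have "f \<circ> \<tau> = \<sigma>" using \<tau> by auto
  ultimately show "\<exists>x. limitin MM.M2.mtopology \<sigma> x sequentially" by auto
qed

lemma hilbert_T: "separable_hilbert_space T"
proof -
  have "separable_space MM.M2.mtopology"
    using G.separable homeomorphic_separable_space homeo_T homeomorphic_map_imp_homeomorphic_space
    by blast
  then show ?thesis
    using inner_T complete_T
    by (simp add: separable_hilbert_space_def separable_hilbert_space_axioms_def)
qed

lemma kazhdan_property_back:
  assumes "kazhdan_property T Q \<epsilon>"
  shows "kazhdan_property G Q \<epsilon>"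
  unfolding kazhdan_property_def
proof (intro allI impI)
  fix U assume U: "unitary_op G U"
    and "\<exists>x\<in>carrier G. hnorm G x = 1 \<and>
           (SUP n\<in>Q. ereal (hdist G (op_powi G U n x) x)) < ereal \<epsilon>"
  then obtain x where x: "x \<in> carrier G" "hnorm G x = 1"
    and sup: "(SUP n\<in>Q. ereal (hdist G (op_powi G U n x) x)) < ereal \<epsilon>" by blast
  define V where "V = f \<circ> U \<circ> inv_into (carrier G) f"
  have V: "V (f u) = f (U u)" if "u \<in> carrier G" for u
    using that inj by (simp add: V_def)
  have UG: "U u \<in> carrier G" if "u \<in> carrier G" for u
    using U that unfolding unitary_op_def by blast
  have Uim: "U ` carrier G = carrier G" using U by (simp add: unitary_op_def)
  have "V ` carrier T = f ` (U ` carrier G)"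
    by (auto simp: V image_image)
  then have Vim: "V ` carrier T = carrier T" by (simp add: Uim)
  have uT: "unitary_op T V"
    using U Vim unfolding unitary_op_def by (auto simp: V UG)
  have injU: "inj_on U (carrier G)"
  proof (rule inj_onI)
    fix u v assume uv: "u \<in> carrier G" "v \<in> carrier G" "U u = U v"
    define w where "w = u \<oplus>\<^bsub>G\<^esub> (- 1) \<odot>\<^bsub>G\<^esub> v"
    have w: "w \<in> carrier G" using uv by (simp add: w_def)
    have "U w = U v \<oplus>\<^bsub>G\<^esub> (- 1) \<odot>\<^bsub>G\<^esub> U v"
      using U uv by (simp add: unitary_op_def w_def)
    also have "\<dots> = \<zero>\<^bsub>G\<^esub>"
      using UG[OF uv(2)] by (simp add: G.minus_eq_smult[symmetric] G.M.r_neg)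
    finally have "ip G w w = 0"
      using U w unfolding unitary_op_def by (metis G.ip_zero(1) G.M.zero_closed)
    then have "w = \<zero>\<^bsub>G\<^esub>" using w G.ip_eq_zero by blast
    then show "u = v" using uv
      by (simp add: w_def G.minus_eq_smult[symmetric])
         (metis G.M.add.inv_closed G.M.minus_equality G.M.minus_minus)
  qed
  have injV: "inj_on V (carrier T)"
  proof (rule inj_onI)
    fix s t assume "s \<in> carrier T" "t \<in> carrier T" "V s = V t"
    then obtain u v where uv: "u \<in> carrier G" "s = f u" "v \<in> carrier G" "t = f v"
      and "f (U u) = f (U v)" by (auto simp: V)
    then have "U u = U v" using inj UG by (blast dest: inj_onD)
    then show "s = t" using injU uv by (blast dest: inj_onD)
  qed
  have inv: "inv_into (carrier T) V (f u) = f (inv_into (carrier G) U u)"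
    and invG: "inv_into (carrier G) U u \<in> carrier G" if u: "u \<in> carrier G" for u
  proof -
    show *: "inv_into (carrier G) U u \<in> carrier G" using u Uim by (metis inv_into_into)
    have "V (f (inv_into (carrier G) U u)) = f u"
      using * u Uim by (simp add: V f_inv_into_f)
    then show "inv_into (carrier T) V (f u) = f (inv_into (carrier G) U u)"
      using injV * by (intro inv_into_f_eq) auto
  qed
  have pw: "(U ^^ k) x \<in> carrier G \<and> (V ^^ k) (f x) = f ((U ^^ k) x)" for k
    by (induction k) (auto simp: x V UG)
  have pw': "(inv_into (carrier G) U ^^ k) x \<in> carrier G \<and>
      (inv_into (carrier T) V ^^ k) (f x) = f ((inv_into (carrier G) U ^^ k) x)" for k
    by (induction k) (auto simp: x inv invG simp del: T_simps(1))
  have "hdist T (op_powi T V n (f x)) (f x) = hdist G (op_powi G U n x) x" for n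
    using pw pw' x by (simp add: op_powi_def hdist_T del: T_simps(1))
  then have "\<exists>y\<in>carrier T. hnorm T y = 1 \<and>
      (SUP n\<in>Q. ereal (hdist T (op_powi T V n y) y)) < ereal \<epsilon>"
    using x sup by (intro bexI[of _ "f x"]) (auto simp: hnorm_T)
  then obtain y where "y \<in> carrier T" "y \<noteq> \<zero>\<^bsub>T\<^esub>" "V y = y"
    using assms uT unfolding kazhdan_property_def by blast
  then obtain u where u: "u \<in> carrier G" "f u \<noteq> f \<zero>\<^bsub>G\<^esub>" "f (U u) = f u" by (auto simp: V)
  then have "U u = u" using inj UG by (meson inj_onD)
  then show "\<exists>y\<in>carrier G. y \<noteq> \<zero>\<^bsub>G\<^esub> \<and> U y = y" using u by metis
qed

end

lemma (in separable_hilbert_space) ex_inj_continuum: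
  "\<exists>f :: 'a \<Rightarrow> nat \<Rightarrow> complex. inj_on f (carrier H)"
proof -
  interpret MS: Metric_space "carrier H" "hdist H" by (rule Metric_space_hdist)
  obtain C where C: "countable C" "C \<subseteq> carrier H" "MS.mtopology closure_of C = carrier H"
    using separable by (auto simp: separable_space_def)
  have ne: "C \<noteq> {}" using C M.zero_closed by (metis closure_of_empty empty_iff)
  define c where "c = from_nat_into C"
  have ran: "range c = C" using C ne by (simp add: c_def range_from_nat_into)
  define f where "f = (\<lambda>x n. complex_of_real (hdist H x (c n)))"
  have "inj_on f (carrier H)"
  proof (rule inj_onI, rule ccontr)
    fix x y assume xy: "x \<in> carrier H" "y \<in> carrier H" "f x = f y" "x \<noteq> y"
    define r where "r = hdist H x y / 2"
    have "hdist H x y > 0" using xy by (simp add: MS.mdist_pos_eq)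
    then have r: "r > 0" by (simp add: r_def)
    have "x \<in> MS.mtopology closure_of C" using xy C by simp
    then obtain z where z: "z \<in> C" "z \<in> MS.mball x r"
      using r by (auto simp: MS.metric_closure_of)
    then obtain n where n: "z = c n" using ran by auto
    have "hdist H x z = hdist H y z" using fun_cong[OF xy(3), of n] by (simp add: f_def n)
    moreover have "hdist H x z < r" "z \<in> carrier H" using z by auto
    ultimately show False
      using MS.triangle[of x z y] xy MS.commute[of z y] by (simp add: r_def)
  qed
  then show ?thesis by blast
qed

lemma kazhdan_property_any_type:
  fixes G :: "'a inner_module"
  assumes "\<forall>H :: (nat \<Rightarrow> complex) inner_module.
             separable_hilbert_space H \<longrightarrow> kazhdan_property H Q \<epsilon>"
    and G: "separable_hilbert_space G"
  shows "kazhdan_property G Q \<epsilon>"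
proof -
  obtain f :: "'a \<Rightarrow> nat \<Rightarrow> complex" where f: "inj_on f (carrier G)"
    using separable_hilbert_space.ex_inj_continuum[OF G] by blast
  interpret inner_space_transport G f "transport f G"
    using G f by (simp add: inner_space_transport_def inner_space_transport_axioms_def)
  show ?thesis using assms(1) hilbert_T kazhdan_property_back by blast
qed

end

theory Submission
  imports Defs "HOL-Probability.Infinite_Product_Measure" "HOL-Probability.Probability_Mass_Function"
begin

text \<open>
  The measure is the law of \<open>\<Prod>j. z j ^ b j\<close>, where the \<open>b j\<close> are independent with values in \<open>{0, 1}\<close>
  and \<open>P (b j = 1) = p j = \<eta> / (j + 1)\<close>, and the \<open>z j = cis (t j)\<close> are points of \<open>C_set m n \<psi>\<close>
  that tend to \<open>1\<close> so fast that for each \<open>k\<close> at most one index \<open>J k\<close> is bad: for \<open>j \<noteq> J k\<close>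
  the powers \<open>z j powi (m k * n k')\<close> with \<open>k' \<le> \<psi> k\<close> are within \<open>\<eta> / 2 ^ (j + J k)\<close> of \<open>1\<close>.
  Then \<open>cmod (fourier_coeff \<mu> (m k * n k') - 1)\<close> is at most \<open>2 * p (J k) + 2 * \<eta> / 2 ^ J k\<close>, which is small and tends
  to \<open>0\<close>. There are no atoms because the product determines the bits and \<open>\<Prod>j. 1 - p j = 0\<close>,
  the series \<open>\<Sum>j. p j\<close> being divergent.

  The Kazhdan property already fails for a diagonal operator on a space of large finite dimension
  \<open>N\<close>, with eigenvalues \<open>z 0, \<dots>, z (N - 1)\<close> different from \<open>1\<close>: the unit vector with equal
  coordinates is moved little, since only the coordinate \<open>J k\<close> is moved much.
\<close>

section \<open>Rapidly decreasing angles\<close>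

text \<open>Near a point of small positive angle \<open>Arg\<close> is continuous, so a whole
  neighbourhood has arguments in the wanted interval, and density puts a point of \<open>C\<close>
  there.\<close>

lemma exists_small_arg:
  assumes dense: "unit_circle \<subseteq> closure C" and "C \<subseteq> unit_circle" "0 < \<delta>"
  shows "\<exists>t. 0 < t \<and> t < \<delta> \<and> cis t \<in> C"
proof -
  define s where "s = min \<delta> pi / 2"
  have s: "0 < s" "s < \<delta>" "s < pi" using assms(3) pi_gt_zero by (auto simp: s_def min_def)
  \<comment> \<open>A positive sine keeps \<open>cis s\<close> off the branch cut of
    \<open>Arg\<close>.\<close>
  have "sin s > 0" using s by (simp add: sin_gt_zero)
  then have "cis s \<notin> \<real>\<^sub>\<le>\<^sub>0" by (auto simp: complex_nonpos_Reals_iff)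
  then have "(Arg \<longlongrightarrow> Arg (cis s)) (nhds (cis s))"
    using continuous_at_Arg tendsto_at_iff_tendsto_nhds continuous_at by blast
  moreover have "Arg (cis s) = s" using s by (intro cis_Arg_unique) (auto simp: sgn_div_norm)
  ultimately have "\<forall>\<^sub>F z in nhds (cis s). Arg z \<in> {0<..<\<delta>}"
    using s by (intro topological_tendstoD[where f = Arg]) auto
  then obtain S where S: "open S" "cis s \<in> S" "\<And>z. z \<in> S \<Longrightarrow> 0 < Arg z \<and> Arg z < \<delta>"
    by (auto simp: eventually_nhds)
  have "cis s \<in> closure C" using dense by auto
  then obtain z where z: "z \<in> S" "z \<in> C" using S by (meson closure_iff_nhds_not_empty disjoint_iff subset_refl)
  then have "cmod z = 1" using assms(2) by auto
  then have "cis (Arg z) = z" by (subst cis_Arg) (auto simp: sgn_div_norm)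
  then show ?thesis using z S(3) by metis
qed

text \<open>A gliding hump: for a fixed angle \<open>D\<close> vanishes as the row \<open>k\<close>
  grows, and in a fixed row it vanishes as the angle shrinks. Alternating the two leaves each row
  with at most one uncontrolled angle. In the application \<open>D t k\<close> is the largest
  deviation from \<open>1\<close> in row \<open>k\<close>.\<close>

lemma sparse_sequence:
  fixes D :: "real \<Rightarrow> nat \<Rightarrow> real"
  assumes acc: "\<And>\<delta>. 0 < \<delta> \<Longrightarrow> \<exists>t. 0 < t \<and> t < \<delta> \<and> t \<in> A"
    and lim: "\<And>t. t \<in> A \<Longrightarrow> D t \<longlonglongrightarrow> 0"
    and lim0: "\<And>k. ((\<lambda>t. D t k) \<longlongrightarrow> 0) (at_right 0)"
    and "0 < \<eta>"
  obtains t :: "nat \<Rightarrow> real" and J :: "nat \<Rightarrow> nat"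
  where "\<And>j. t j \<in> A" "\<And>j. 0 < t j" "t 0 < 1" "\<And>j. t (Suc j) \<le> t j / 4"
    and "filterlim J at_top at_top"
    and "\<And>k i. i \<noteq> J k \<Longrightarrow> D (t i) k \<le> \<eta> * (1/2) ^ i * (1/2) ^ J k"
proof -
  \<comment> \<open>A state \<open>(t, F, K)\<close> at stage \<open>j\<close> holds the current point, the set of the points
    chosen up to now and a threshold \<open>K\<close> beyond which all of them are good. The next point is taken
    so small that it is good below \<open>K\<close>; hence it can be bad only between two thresholds.\<close>
  define P where "P j x = (case x of (t, F, K) \<Rightarrow> t \<in> F \<and> 0 < t \<and> t < 1 \<and> finite F \<and> F \<subseteq> A \<and>
     (\<forall>s\<in>F. \<forall>k\<ge>K. D s k \<le> \<eta> * (1/4) ^ Suc j))" for j :: nat and x :: "real \<times> real set \<times> nat"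
  define Q where "Q j x y = (case (x, y) of ((t, F, K), (t', F', K')) \<Rightarrow> t' \<le> t / 4 \<and> F \<subseteq> F' \<and> K < K' \<and>
     (\<forall>k<K. D t' k \<le> \<eta> * (1/4) ^ Suc j))" for j :: nat and x y :: "real \<times> real set \<times> nat"
  \<comment> \<open>The strict \<open>K>L\<close> later gives \<open>j \<le> K j\<close>, so that
    every row lies below some threshold.\<close>
  have ex_K: "\<exists>K>L. \<forall>s\<in>F. \<forall>k\<ge>K. D s k \<le> \<delta>" if "finite F" "F \<subseteq> A" "0 < \<delta>" for F L \<delta>
  proof -
    have "\<forall>\<^sub>F k in sequentially. \<forall>s\<in>F. D s k \<le> \<delta>"
    proof (intro eventually_ball_finite ballI that)
      fix s assume "s \<in> F"
      then have "s \<in> A" using that by auto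
      then show "\<forall>\<^sub>F k in sequentially. D s k \<le> \<delta>"
        by (intro eventually_mono[OF order_tendstoD(2)[OF lim \<open>0 < \<delta>\<close>] less_imp_le])
    qed
    then obtain K where "\<forall>k\<ge>K. \<forall>s\<in>F. D s k \<le> \<delta>" by (auto simp: eventually_sequentially)
    then show ?thesis by (intro exI[of _ "max K (Suc L)"]) auto
  qed
  have ex_t: "\<exists>t\<in>A. 0 < t \<and> t \<le> b \<and> (\<forall>k<L. D t k \<le> \<delta>)" if "0 < b" "0 < \<delta>" for b \<delta> L
  proof -
    have "\<forall>\<^sub>F t in at_right 0. \<forall>k\<in>{..<L}. D t k \<le> \<delta>"
      by (intro eventually_ball_finite ballI)
         (auto intro: eventually_mono[OF order_tendstoD(2)[OF lim0 \<open>0 < \<delta>\<close>] less_imp_le])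
    then obtain b' where b': "0 < b'" "\<And>t. 0 < t \<Longrightarrow> t < b' \<Longrightarrow> \<forall>k<L. D t k \<le> \<delta>"
      by (auto simp: eventually_at_right_field)
    show ?thesis using acc[of "min b b'"] b' that by (meson less_imp_le min_less_iff_conj)
  qed
  have "\<exists>f. \<forall>j. P j (f j) \<and> Q j (f j) (f (Suc j))"
  proof (rule dependent_nat_choice)
    obtain t where t: "t \<in> A" "0 < t" "t < 1" using acc[of 1] by auto
    obtain K where "\<forall>k\<ge>K. D t k \<le> \<eta> * (1/4) ^ Suc 0"
      using ex_K[of "{t}" "\<eta> * (1/4) ^ Suc 0" 0] t \<open>0 < \<eta>\<close> by auto
    then show "\<exists>x. P 0 x" using t by (intro exI[of _ "(t, {t}, K)"]) (auto simp: P_def)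
  next
    fix x j assume "P j x"
    moreover obtain t F K where x: "x = (t, F, K)" by (cases x)
    ultimately have P: "0 < t" "t < 1" "finite F" "F \<subseteq> A" by (auto simp: P_def)
    obtain t' where t': "t' \<in> A" "0 < t'" "t' \<le> t / 4" "\<forall>k<K. D t' k \<le> \<eta> * (1/4) ^ Suc j"
      using ex_t[of "t / 4" "\<eta> * (1/4) ^ Suc j" K] P \<open>0 < \<eta>\<close> by auto
    obtain K' where "K < K'" "\<forall>s\<in>insert t' F. \<forall>k\<ge>K'. D s k \<le> \<eta> * (1/4) ^ Suc (Suc j)"
      using ex_K[of "insert t' F" "\<eta> * (1/4) ^ Suc (Suc j)" K] P t' \<open>0 < \<eta>\<close> by auto
    then show "\<exists>y. P (Suc j) y \<and> Q j x y"
      using P t' by (intro exI[of _ "(t', insert t' F, K')"]) (auto simp: P_def Q_def x)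
  qed
  then obtain f where f: "\<And>j. P j (f j)" "\<And>j. Q j (f j) (f (Suc j))" by blast
  define t F K where "t j = fst (f j)" and "F j = fst (snd (f j))" and "K j = snd (snd (f j))" for j
  have eq: "f j = (t j, F j, K j)" for j by (simp add: t_def F_def K_def)
  have P: "t j \<in> F j" "0 < t j" "t j < 1" "F j \<subseteq> A" "\<And>s k. s \<in> F j \<Longrightarrow> K j \<le> k \<Longrightarrow> D s k \<le> \<eta> * (1/4) ^ Suc j" for j
    using f(1)[of j] by (auto simp: P_def eq)
  have Q: "t (Suc j) \<le> t j / 4" "F j \<subseteq> F (Suc j)" "K j < K (Suc j)"
      "\<And>k. k < K j \<Longrightarrow> D (t (Suc j)) k \<le> \<eta> * (1/4) ^ Suc j" for j
    using f(2)[of j] by (auto simp: Q_def eq)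
  have "strict_mono K" using Q(3) by (simp add: strict_mono_Suc_iff)
  then have K_ge: "j \<le> K j" for j by (rule strict_mono_imp_increasing)
  have tF: "t i \<in> F j" if "i \<le> j" for i j
    using that P(1) Q(2) lift_Suc_mono_le[of F i j] by blast
  \<comment> \<open>The stage whose threshold first exceeds \<open>k\<close>. Earlier points are
    good in row \<open>k\<close> because the preceding threshold is already passed; later points
    were chosen small on all rows below \<open>K (J k)\<close>. Only \<open>t (J k)\<close> escapes
    both.\<close>
  define J where "J k = (LEAST j. k < K j)" for k
  have J: "k < K (J k)" for k
    unfolding J_def using K_ge[of "Suc k"] by (intro LeastI[of "\<lambda>j. k < K j" "Suc k"]) simp
  have J': "K j \<le> k" if "j < J k" for j k
    using not_less_Least[of j "\<lambda>j. k < K j"] that by (simp add: J_def)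
  have "filterlim J at_top at_top"
    unfolding filterlim_at_top
  proof
    fix j
    have "j \<le> J k" if "K j \<le> k" for k
      using J[of k] that \<open>strict_mono K\<close> by (metis le_less_trans less_imp_le strict_mono_less)
    then show "\<forall>\<^sub>F k in at_top. j \<le> J k" by (auto simp: eventually_at_top_linorder)
  qed
  moreover have "D (t i) k \<le> \<eta> * (1/2) ^ i * (1/2) ^ J k" if "i \<noteq> J k" for i k
  proof -
    have "D (t i) k \<le> \<eta> * (1/4) ^ max i (J k)"
    proof (cases "i < J k")
      case True
      then obtain j where j: "J k = Suc j" "i \<le> j" by (cases "J k") auto
      then show ?thesis using P(5)[OF tF[OF j(2)], of k] J'[of j k] by (simp add: max_def)
    next
      case False
      then have "J k < i" using that by simp
      then obtain i' where i: "i = Suc i'" "J k \<le> i'" by (cases i) auto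
      then have "k < K i'" using J[of k] \<open>strict_mono K\<close> by (meson less_le_trans strict_mono_less_eq)
      then show ?thesis using Q(4)[of k i'] i by (simp add: max_def)
    qed
    \<comment> \<open>Powers of \<open>1/4\<close> were demanded because twice the maximum is at
      least the sum of the two indices; the resulting bound is summable in \<open>i\<close> and
      vanishes with growing \<open>J k\<close>.\<close>
    also have "(1/4) ^ max i (J k) = ((1/2::real) ^ (max i (J k) + max i (J k)))"
      by (simp add: power_add flip: power_mult_distrib)
    also have "\<dots> \<le> (1/2) ^ (i + J k)" by (intro power_decreasing) auto
    finally show ?thesis using \<open>0 < \<eta>\<close> by (simp add: power_add mult.assoc)
  qed
  ultimately show thesis using that[of t J] P Q(1) by blast
qed

section \<open>Random products on the circle\<close>

text \<open>The ratio \<open>1/4\<close> lets each term exceed the sum of all later ones, so that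
  bits can be recovered from subset sums; \<open>t 0 < 1\<close> keeps these sums below a full
  turn.\<close>

locale quarter_sequence =
  fixes t :: "nat \<Rightarrow> real"
  assumes pos: "0 < t j" and step: "t (Suc j) \<le> t j / 4" and first: "t 0 < 1"
begin

text \<open>The angle of the random product: \<open>cis (subsum b)\<close> is the product of the
  \<open>cis (t j)\<close> over the selected \<open>j\<close>.\<close>

definition subsum :: "(nat \<Rightarrow> bool) \<Rightarrow> real" where
  "subsum b = (\<Sum>j. of_bool (b j) * t j)"

lemma geometric_bound: "t (i + j) \<le> t j * (1/4) ^ i"
proof (induction i)
  case (Suc i)
  then show ?case using step[of "i + j"] by simp
qed simp

lemma summable_t: "summable t"
proof (rule summable_comparison_test')
  show "summable (\<lambda>i. t 0 * (1/4) ^ i)" by (intro summable_mult summable_geometric) simp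
  show "norm (t i) \<le> t 0 * (1/4) ^ i" for i
    using geometric_bound[of i 0] pos[of i] by simp
qed

lemma summable_subsum: "summable (\<lambda>j. of_bool (b j) * t j)"
  by (rule summable_comparison_test'[OF summable_t, where N = 0]) (auto simp: less_imp_le pos)

lemma tail_bound: "(\<Sum>i. t (i + j)) \<le> t j * (4/3)"
proof -
  have "(\<Sum>i. t (i + j)) \<le> (\<Sum>i. t j * (1/4) ^ i)"
    by (intro suminf_le geometric_bound summable_mult summable_geometric
        summable_ignore_initial_segment summable_t) simp
  also have "\<dots> = t j * (4/3)"
    by (subst suminf_mult) (auto simp: suminf_geometric summable_geometric)
  finally show ?thesis .
qed

lemma subsum_tail_le: "(\<Sum>i. of_bool (b (i + j)) * t (i + j)) \<le> t j * (4/3)"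
proof -
  have "(\<Sum>i. of_bool (b (i + j)) * t (i + j)) \<le> (\<Sum>i. t (i + j))"
    using summable_subsum summable_t pos
    by (intro suminf_le summable_ignore_initial_segment[where f = "\<lambda>i. of_bool (b i) * t i"]
        summable_ignore_initial_segment[where f = t]) (auto simp: less_imp_le)
  then show ?thesis using tail_bound[of j] by linarith
qed

lemma subsum_tail_nonneg: "0 \<le> (\<Sum>i. of_bool (b (i + j)) * t (i + j))"
  using summable_subsum pos
  by (intro suminf_nonneg summable_ignore_initial_segment[where f = "\<lambda>i. of_bool (b i) * t i"])
     (auto simp: less_imp_le)

lemma subsum_split:
  "subsum b = (\<Sum>i. of_bool (b (i + j)) * t (i + j)) + (\<Sum>i<j. of_bool (b i) * t i)"
  unfolding subsum_def by (rule suminf_split_initial_segment[OF summable_subsum])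

lemma subsum_bounds: "0 \<le> subsum b" "subsum b < 2 * pi"
  using subsum_tail_le[of b 0] subsum_tail_nonneg[of b 0] first pi_gt3 by (simp_all add: subsum_def)

text \<open>Subset sums respect the lexicographic order: \<open>t j\<close> outweighs whatever
  \<open>c\<close> selects after \<open>j\<close>, which is at most \<open>4/3 * t (Suc j)\<close>
  and hence at most \<open>t j / 3\<close>.\<close>

lemma subsum_less:
  assumes "b j" "\<not> c j" "\<And>i. i < j \<Longrightarrow> b i = c i"
  shows "subsum c < subsum b"
proof -
  have "subsum b = (\<Sum>i. of_bool (b (i + Suc j)) * t (i + Suc j)) + t j + (\<Sum>i<j. of_bool (b i) * t i)"
    using subsum_split[of b "Suc j"] assms(1) by simp
  moreover have "subsum c = (\<Sum>i. of_bool (c (i + Suc j)) * t (i + Suc j)) + (\<Sum>i<j. of_bool (c i) * t i)"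
    using subsum_split[of c "Suc j"] assms(2) by simp
  moreover have "(\<Sum>i<j. of_bool (b i) * t i) = (\<Sum>i<j. of_bool (c i) * t i)"
    using assms(3) by (intro sum.cong) auto
  ultimately show ?thesis
    using subsum_tail_nonneg[of b "Suc j"] subsum_tail_le[of c "Suc j"] step[of j] pos[of j] by linarith
qed

lemma inj_subsum: "inj subsum"
proof (rule injI, rule ccontr)
  fix b c assume eq: "subsum b = subsum c" and "b \<noteq> c"
  then have ex: "\<exists>i. b i \<noteq> c i" by blast
  define j where "j = (LEAST i. b i \<noteq> c i)"
  have "b j \<noteq> c j" unfolding j_def using ex by (rule LeastI_ex)
  have less: "b i = c i" if "i < j" for i
    using that not_less_Least[of i "\<lambda>i. b i \<noteq> c i"] unfolding j_def by simp
  show False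
  proof (cases "b j")
    case True
    then show False using subsum_less[of b j c] less eq \<open>b j \<noteq> c j\<close> by simp
  next
    case False
    then show False using subsum_less[of c j b] less eq \<open>b j \<noteq> c j\<close> by simp
  qed
qed

text \<open>All angles lie in \<open>[0, 2 * pi)\<close>, where \<open>cis\<close> is injective. The
  absence of atoms will rest on this.\<close>

lemma inj_cis_subsum: "inj (\<lambda>b. cis (subsum b))"
proof (rule injI)
  fix b c assume "cis (subsum b) = cis (subsum c)"
  then have "exp (\<i> * complex_of_real (subsum b)) = exp (\<i> * complex_of_real (subsum c))"
    by (simp add: cis_conv_exp)
  then have "\<i> * complex_of_real (subsum b) = \<i> * complex_of_real (subsum c)"
  proof (rule exp_complex_eqI[rotated])
    show "\<bar>Im (\<i> * complex_of_real (subsum b)) - Im (\<i> * complex_of_real (subsum c))\<bar> < 2 * pi"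
      using subsum_bounds[of b] subsum_bounds[of c] by (simp add: abs_if)
  qed
  then show "b = c" by (intro injD[OF inj_subsum]) simp
qed

text \<open>The distance of a product of unimodular numbers from \<open>1\<close> is at most the sum
  of the distances of the factors, and this survives the limit. A bound linear in the bits is wanted
  because its expectation can be read off term by term.\<close>

lemma cis_subsum_le:
  "cmod (cis (N * subsum b) - 1) \<le> (\<Sum>j. of_bool (b j) * cmod (cis (N * t j) - 1))"
  and summable_cis: "summable (\<lambda>j. cmod (cis (N * t j) - 1))"
proof -
  \<comment> \<open>The chord is at most the arc, so the deviations inherit the summability of
    \<open>t\<close>.\<close>
  have le: "cmod (cis x - 1) \<le> \<bar>x\<bar>" for x
    using dist_exp_i_1[of x] abs_sin_x_le_abs_x[of "x / 2"] by (simp add: cis_conv_exp)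
  show sm: "summable (\<lambda>j. cmod (cis (N * t j) - 1))"
  proof (rule summable_comparison_test')
    show "summable (\<lambda>j. \<bar>N\<bar> * t j)" by (intro summable_mult summable_t)
    show "norm (cmod (cis (N * t j) - 1)) \<le> \<bar>N\<bar> * t j" for j
      using le[of "N * t j"] pos[of j] by (simp add: abs_mult)
  qed
  have sm': "summable (\<lambda>j. of_bool (b j) * cmod (cis (N * t j) - 1))"
    using sm by (rule summable_comparison_test'[where N = 0]) auto
  have "cmod (cis (N * (\<Sum>j<n. of_bool (b j) * t j)) - 1) \<le> (\<Sum>j<n. of_bool (b j) * cmod (cis (N * t j) - 1))" for n
  proof (induction n)
    case (Suc n)
    have mul: "cmod (cis (x + y) - 1) \<le> cmod (cis x - 1) + cmod (cis y - 1)" for x y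
    proof -
      have "cis (x + y) - 1 = (cis x - 1) * cis y + (cis y - 1)"
        by (simp add: cis_mult[symmetric] algebra_simps)
      then have "cmod (cis (x + y) - 1) \<le> cmod ((cis x - 1) * cis y) + cmod (cis y - 1)"
        by (simp only: norm_triangle_ineq)
      then show ?thesis by (simp only: norm_mult norm_cis mult_1_right)
    qed
    show ?case
      using Suc mul[of "N * (\<Sum>j<n. of_bool (b j) * t j)" "N * t n"]
      by (cases "b n") (simp_all add: distrib_left)
  qed simp
  moreover have "(\<lambda>n. cmod (cis (N * (\<Sum>j<n. of_bool (b j) * t j)) - 1)) \<longlonglongrightarrow> cmod (cis (N * subsum b) - 1)"
    unfolding subsum_def cis_conv_exp by (intro tendsto_intros summable_LIMSEQ summable_subsum)
  moreover note summable_LIMSEQ[OF sm']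
  ultimately show "cmod (cis (N * subsum b) - 1) \<le> (\<Sum>j. of_bool (b j) * cmod (cis (N * t j) - 1))"
    by (intro LIMSEQ_le) auto
qed

end

section \<open>The law of the random product\<close>

lemma prod_one_minus_tendsto_0:
  fixes p :: "nat \<Rightarrow> real"
  assumes "\<And>i. 0 \<le> p i" "\<And>i. p i \<le> 1" "\<not> summable p"
  shows "(\<lambda>n. \<Prod>i<n. 1 - p i) \<longlonglongrightarrow> 0"
proof (rule tendsto_sandwich[where f = "\<lambda>_. 0" and h = "\<lambda>n. exp (- (\<Sum>i<n. p i))"])
  show "\<forall>\<^sub>F n in sequentially. (\<Prod>i<n. 1 - p i) \<le> exp (- (\<Sum>i<n. p i))"
  proof (intro always_eventually allI)
    fix n
    \<comment> \<open>The inequality \<open>1 - x \<le> exp (- x)\<close> turns divergence of the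
      sum into decay of the product.\<close>
    have "(\<Prod>i<n. 1 - p i) \<le> (\<Prod>i<n. exp (- p i))"
      using assms exp_ge_add_one_self[of "- p _"] by (intro prod_mono) auto
    then show "(\<Prod>i<n. 1 - p i) \<le> exp (- (\<Sum>i<n. p i))" by (simp add: exp_sum sum_negf[symmetric])
  qed
  have "filterlim (\<lambda>n. \<Sum>i<n. p i) at_top sequentially"
    unfolding filterlim_at_top
  proof
    fix c
    obtain n where n: "c < (\<Sum>i<n. p i)"
      using summableI_nonneg_bounded[of p c] assms(1,3) by (meson not_le)
    have "c \<le> (\<Sum>i<m. p i)" if "n \<le> m" for m
      using n sum_mono2[of "{..<m}" "{..<n}" p] that assms(1) by auto
    then show "\<forall>\<^sub>F n in sequentially. c \<le> (\<Sum>i<n. p i)" by (auto simp: eventually_sequentially)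
  qed
  then show "(\<lambda>n. exp (- (\<Sum>i<n. p i))) \<longlonglongrightarrow> 0"
    by (intro filterlim_compose[OF exp_at_bot]) (simp add: filterlim_uminus_at_bot)
qed (use assms in \<open>auto intro!: always_eventually prod_nonneg\<close>)

text \<open>The measure is the law of \<open>cis (subsum b)\<close> for independent bits that are
  true with probability \<open>p j\<close>. Taking expectations in \<open>cis_subsum_le\<close>
  gives the Fourier bound; divergence of the sum of the \<open>p j\<close> removes the
  atoms.\<close>

lemma (in quarter_sequence) ex_bernoulli_measure:
  fixes p :: "nat \<Rightarrow> real"
  assumes p: "\<And>i. 0 \<le> p i" "\<And>i. p i \<le> 1/2" and "\<not> summable p"
  shows "\<exists>\<mu>. circle_probability \<mu> \<and> continuous_measure \<mu> \<and>
    (\<forall>N. cmod (fourier_coeff \<mu> N - 1) \<le> (\<Sum>j. p j * cmod (cis (N * t j) - 1)))"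
proof -
  define B where "B j = measure_pmf (bernoulli_pmf (p j))" for j
  have p1: "p i \<le> 1" for i using p(2)[of i] by simp
  have [measurable_cong, simp]: "sets (B j) = sets (count_space UNIV)" for j by (simp add: B_def)
  interpret P: product_prob_space B UNIV
    by unfold_locales (auto simp: B_def measure_pmf.emeasure_space_1 intro: measure_pmf.sigma_finite_countable)
  define M where "M = PiM UNIV B"
  interpret M: prob_space M unfolding M_def by (rule P.prob_space_axioms)
  have space_M: "space M = UNIV" by (auto simp: M_def space_PiM B_def)
  have coord [measurable]: "(\<lambda>b. b j) \<in> measurable M (count_space UNIV)" for j
    unfolding M_def using measurable_component_singleton[of j UNIV B]
    by (simp add: measurable_cong_sets[OF refl, of "B j" "count_space UNIV"])
  have [measurable]: "subsum \<in> borel_measurable M" unfolding subsum_def by measurable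
  have [measurable]: "(\<lambda>b. cis (subsum b)) \<in> borel_measurable M"
    unfolding cis_conv_exp by measurable
  define \<mu> where "\<mu> = distr M (restrict_space borel unit_circle) (\<lambda>b. cis (subsum b))"
  have meas [measurable]: "(\<lambda>b. cis (subsum b)) \<in> measurable M (restrict_space borel unit_circle)"
    by (intro measurable_restrict_space2) auto
  have "circle_probability \<mu>"
    unfolding circle_probability_def \<mu>_def using M.prob_space_distr[OF meas] by simp
  moreover have "continuous_measure \<mu>"
    unfolding continuous_measure_def
  proof
    fix z assume z: "z \<in> unit_circle"
    define V where "V = (\<lambda>b. cis (subsum b)) -` {z} \<inter> space M"
    have "{z} \<in> sets (restrict_space borel unit_circle)" using z by (auto simp: sets_restrict_space_iff)
    then have "measure \<mu> {z} = measure M V"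
      unfolding \<mu>_def V_def by (rule measure_distr[OF meas])
    also have "\<dots> = 0"
    proof (cases "V = {}")
      case False
      then obtain c where c: "c \<in> V" by auto
      \<comment> \<open>By injectivity the fibre over \<open>z\<close> is the single sequence
        \<open>c\<close>.\<close>
      have V: "b = c" if "b \<in> V" for b
        using that c inj_cis_subsum by (auto simp: V_def dest: injD)
      have "measure M V \<le> (\<Prod>i<n. 1 - p i)" for n
      proof -
        \<comment> \<open>The cylinder of the sequences that agree with \<open>c\<close> in the
          first \<open>n\<close> bits; by independence its measure is a finite product.\<close>
        let ?S = "{b \<in> space M. \<forall>i\<in>{..<n}. b i \<in> {c i}}"
        have [measurable]: "Measurable.pred M (\<lambda>b. b i \<in> {c i})" for i
          using measurable_compose[OF coord[of i], of "\<lambda>x. x \<in> {c i}" "count_space UNIV"] by simp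
        have "?S \<in> sets M" by measurable
        then have "measure M V \<le> measure M ?S"
          using V by (intro M.finite_measure_mono) (auto simp: space_M)
        also have "\<dots> = (\<Prod>i<n. measure (B i) {c i})"
          using P.emeasure_PiM_Collect[of "{..<n}" "\<lambda>i. {c i}"]
          unfolding M_def[symmetric] M.emeasure_eq_measure P.M.emeasure_eq_measure
          by (simp add: prod_ennreal measure_nonneg prod_nonneg)
        also have "\<dots> \<le> (\<Prod>i<n. 1 - p i)"
        proof (intro prod_mono conjI)
          fix i
          \<comment> \<open>Since \<open>p i \<le> 1/2\<close>, either value of the bit has
            probability at most \<open>1 - p i\<close>.\<close>
          show "measure (B i) {c i} \<le> 1 - p i"
            using p[of i] p1[of i] by (cases "c i") (auto simp: B_def measure_pmf_single)
        qed simp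
        finally show ?thesis .
      qed
      then have "measure M V \<le> 0"
        using prod_one_minus_tendsto_0[OF p(1) p1 assms(3)] by (intro LIMSEQ_le_const) auto
      then show ?thesis by (simp add: measure_le_0_iff)
    qed simp
    finally show "measure \<mu> {z} = 0" .
  qed
  moreover have "cmod (fourier_coeff \<mu> N - 1) \<le> (\<Sum>j. p j * cmod (cis (N * t j) - 1))" for N :: int
  proof -
    let ?d = "\<lambda>j. cmod (cis (N * t j) - 1)"
    have [measurable]: "(\<lambda>z. z powi N) \<in> borel_measurable (borel :: complex measure)"
      unfolding power_int_def by measurable
    have "fourier_coeff \<mu> N = (\<integral>b. cis (subsum b) powi N \<partial>M)"
      unfolding fourier_coeff_def \<mu>_def by (subst integral_distr[OF meas]) (auto intro: measurable_restrict_space1)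
    also have "\<dots> = (\<integral>b. cis (N * subsum b) \<partial>M)" by (simp add: cis_power_int mult.commute)
    finally have F: "fourier_coeff \<mu> N = (\<integral>b. cis (N * subsum b) \<partial>M)" .
    have cisN [measurable]: "(\<lambda>b. cis (N * subsum b)) \<in> borel_measurable M"
      unfolding cis_conv_exp by measurable
    have int: "integrable M (\<lambda>b. cis (N * subsum b))"
      by (intro M.integrable_const_bound[of _ 1]) auto
    have E: "(\<integral>b. of_bool (b j) * ?d j \<partial>M) = p j * ?d j" "integrable M (\<lambda>b. of_bool (b j) * ?d j)" for j
    proof -
      \<comment> \<open>The integrand depends on bit \<open>j\<close> alone, so it can be integrated
        against the marginal law \<open>B j\<close>.\<close>
      have "(\<integral>b. of_bool (b j) * ?d j \<partial>M) = (\<integral>x. of_bool x * ?d j \<partial>distr M (B j) (\<lambda>b. b j))"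
        by (rule integral_distr[symmetric]) (simp_all add: M_def, simp add: B_def)
      also have "distr M (B j) (\<lambda>b. b j) = B j" unfolding M_def by (rule P.PiM_component) simp
      also have "(\<integral>x. of_bool x * ?d j \<partial>B j) = p j * ?d j" using p p1 by (simp add: B_def)
      finally show "(\<integral>b. of_bool (b j) * ?d j \<partial>M) = p j * ?d j" .
      show "integrable M (\<lambda>b. of_bool (b j) * ?d j)"
        by (intro M.integrable_const_bound[of _ "?d j"]) auto
    qed
    have sm: "summable (\<lambda>j. of_bool (b j) * ?d j)" for b
      using summable_cis[of N] by (rule summable_comparison_test'[where N = 0]) auto
    have sm': "summable (\<lambda>j. p j * ?d j)"
      using summable_cis[of N] p p1
      by (rule_tac summable_comparison_test'[where N = 0]) (auto simp: abs_mult mult_left_le_one_le)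
    have nrm: "norm (of_bool (b j) * ?d j) = of_bool (b j) * ?d j" for b :: "nat \<Rightarrow> bool" and j by simp
    \<comment> \<open>Summability pointwise and in mean allows the sum and the expectation to be
      exchanged.\<close>
    have AE: "AE b in M. summable (\<lambda>j. norm (of_bool (b j) * ?d j))"
      by (intro AE_I2) (simp only: nrm sm)
    have SI: "summable (\<lambda>j. \<integral>b. norm (of_bool (b j) * ?d j) \<partial>M)"
      by (simp only: nrm E(1) sm')
    have "fourier_coeff \<mu> N - 1 = (\<integral>b. cis (N * subsum b) - 1 \<partial>M)"
      unfolding F by (subst Bochner_Integration.integral_diff[OF int]) (auto simp: M.prob_space)
    then have "cmod (fourier_coeff \<mu> N - 1) \<le> (\<integral>b. cmod (cis (N * subsum b) - 1) \<partial>M)"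
      by simp
    also have "\<dots> \<le> (\<integral>b. (\<Sum>j. of_bool (b j) * ?d j) \<partial>M)"
    proof (rule integral_mono)
      show "integrable M (\<lambda>b. cmod (cis (N * subsum b) - 1))"
        using int by (intro integrable_norm Bochner_Integration.integrable_diff) auto
      show "integrable M (\<lambda>b. \<Sum>j. of_bool (b j) * ?d j)"
        by (rule integrable_suminf[OF E(2) AE SI])
    qed (rule cis_subsum_le)
    also have "\<dots> = (\<Sum>j. p j * ?d j)"
      by (simp only: integral_suminf[OF E(2) AE SI] E(1))
    finally show ?thesis .
  qed
  ultimately show ?thesis by blast
qed

section \<open>Diagonal operators on finite-dimensional spaces\<close>

text \<open>The Hilbert space C^N, realised by sequences vanishing from \<open>N\<close> on so that
  its elements have the type over which \<open>kazhdan_subset\<close> quantifies.\<close>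

definition coord_space :: "nat \<Rightarrow> (nat \<Rightarrow> complex) inner_module" where
  "coord_space N = \<lparr>carrier = {f. \<forall>i\<ge>N. f i = 0}, mult = undefined, one = undefined,
     zero = (\<lambda>i. 0), add = (\<lambda>f g i. f i + g i), smult = (\<lambda>a f i. a * f i),
     ip = (\<lambda>f g. \<Sum>i<N. f i * cnj (g i))\<rparr>"

lemma coord_space_simps [simp]:
  "carrier (coord_space N) = {f. \<forall>i\<ge>N. f i = 0}"
  "\<zero>\<^bsub>coord_space N\<^esub> = (\<lambda>i. 0)"
  "f \<oplus>\<^bsub>coord_space N\<^esub> g = (\<lambda>i. f i + g i)"
  "a \<odot>\<^bsub>coord_space N\<^esub> f = (\<lambda>i. a * f i)"
  "ip (coord_space N) f g = (\<Sum>i<N. f i * cnj (g i))"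
  by (simp_all add: coord_space_def)

lemma hnorm_coord_space: "hnorm (coord_space N) f = sqrt (\<Sum>i<N. (cmod (f i))\<^sup>2)"
  by (simp add: hnorm_def complex_mult_cnj flip: cmod_power2)

lemma complex_inner_space_coord_space: "complex_inner_space (coord_space N)"
proof -
  interpret abelian_group "coord_space N"
  proof (rule abelian_groupI)
    fix x assume "x \<in> carrier (coord_space N)"
    then show "\<exists>y\<in>carrier (coord_space N). y \<oplus>\<^bsub>coord_space N\<^esub> x = \<zero>\<^bsub>coord_space N\<^esub>"
      by (intro bexI[of _ "\<lambda>i. - x i"]) auto
  qed (auto simp: add_ac)
  have "module complex_ring (coord_space N)"
    by (rule moduleI)
       (use cring_complex_ring abelian_group_axioms in \<open>auto simp: complex_ring_def algebra_simps\<close>)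
  moreover have "f = (\<lambda>i. 0)" if "\<forall>i\<ge>N. f i = 0" "(\<Sum>i<N. f i * cnj (f i)) = 0" for f :: "nat \<Rightarrow> complex"
  proof -
    have "complex_of_real (\<Sum>i<N. (cmod (f i))\<^sup>2) = 0"
      using that(2) by (simp add: complex_mult_cnj flip: cmod_power2)
    then have "(\<Sum>i<N. (cmod (f i))\<^sup>2) = 0" using of_real_eq_0_iff by blast
    then have "f i = 0" if "i < N" for i using that by (simp add: sum_nonneg_eq_0_iff)
    then show ?thesis using that(1) by (meson ext not_le)
  qed
  ultimately show ?thesis
    unfolding complex_inner_space_def complex_inner_space_axioms_def
    by (auto simp: sum.distrib algebra_simps sum_distrib_left intro!: sum_nonneg add_nonneg_nonneg)
qed

section \<open>Metric, completeness and separability of C^N\<close>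

lemma hdist_coord_space:
  assumes "f \<in> carrier (coord_space N)" "g \<in> carrier (coord_space N)"
  shows "hdist (coord_space N) f g = sqrt (\<Sum>i<N. (cmod (f i - g i))\<^sup>2)"
proof -
  interpret complex_inner_space "coord_space N" by (rule complex_inner_space_coord_space)
  have "f \<ominus>\<^bsub>coord_space N\<^esub> g = (\<lambda>i. f i - g i)"
    using minus_eq_smult[OF assms(2)] by (simp add: a_minus_def)
  then show ?thesis using assms by (simp add: hdist_def hnorm_coord_space)
qed

text \<open>The Euclidean norm is at most the sum of the moduli of the coordinates; the crude factor
  \<open>N\<close> suffices for the density argument below.\<close>

lemma hdist_coord_space_le:
  assumes "f \<in> carrier (coord_space N)" "g \<in> carrier (coord_space N)"
    and "\<And>i. i < N \<Longrightarrow> cmod (f i - g i) \<le> \<delta>"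
  shows "hdist (coord_space N) f g \<le> real N * \<delta>"
proof -
  have "hdist (coord_space N) f g = L2_set (\<lambda>i. cmod (f i - g i)) {..<N}"
    using assms(1,2) by (simp add: hdist_coord_space L2_set_def)
  also have "\<dots> \<le> (\<Sum>i<N. cmod (f i - g i))" by (rule L2_set_le_sum) simp
  also have "\<dots> \<le> real N * \<delta>" using sum_mono[of "{..<N}" "\<lambda>i. cmod (f i - g i)" "\<lambda>_. \<delta>"] assms(3) by simp
  finally show ?thesis .
qed

text \<open>This carries the Cauchy property over to the coordinates. From index \<open>N\<close> on
  both coordinates are \<open>0\<close> and the bound is nonnegativity of the distance.\<close>

lemma cmod_le_hdist_coord_space:
  assumes "f \<in> carrier (coord_space N)" "g \<in> carrier (coord_space N)"
  shows "cmod (f i - g i) \<le> hdist (coord_space N) f g"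
proof (cases "i < N")
  case True
  have "hdist (coord_space N) f g = L2_set (\<lambda>i. cmod (f i - g i)) {..<N}"
    using assms by (simp add: hdist_coord_space L2_set_def)
  then show ?thesis using True member_le_L2_set[of "{..<N}" i "\<lambda>i. cmod (f i - g i)"] by simp
next
  case False
  interpret complex_inner_space "coord_space N" by (rule complex_inner_space_coord_space)
  interpret Metric_space "carrier (coord_space N)" "hdist (coord_space N)" by (rule Metric_space_hdist)
  show ?thesis using False assms nonneg[of f g] by simp
qed

lemma separable_hilbert_space_coord_space: "separable_hilbert_space (coord_space N)"
proof -
  let ?H = "coord_space N"
  interpret complex_inner_space ?H by (rule complex_inner_space_coord_space)
  interpret Metric_space "carrier ?H" "hdist ?H" by (rule Metric_space_hdist)
  \<comment> \<open>Finitely many coordinates enter the distance, so coordinatewise convergence is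
    metric convergence.\<close>
  have lim: "limitin mtopology \<sigma> f sequentially"
    if \<sigma>: "\<And>n. \<sigma> n \<in> carrier ?H" and f: "f \<in> carrier ?H" and "\<And>i. (\<lambda>n. \<sigma> n i) \<longlonglongrightarrow> f i" for \<sigma> f
  proof -
    have "(\<lambda>n. sqrt (\<Sum>i<N. (cmod (\<sigma> n i - f i))\<^sup>2)) \<longlonglongrightarrow> sqrt (\<Sum>i<N. (cmod (f i - f i))\<^sup>2)"
      using that(3) by (intro tendsto_intros)
    then have "(\<lambda>n. hdist ?H (\<sigma> n) f) \<longlonglongrightarrow> 0"
      using hdist_coord_space[OF \<sigma> f] by simp
    then have "\<exists>n0. \<forall>n\<ge>n0. hdist ?H (\<sigma> n) f < \<epsilon>" if "\<epsilon> > 0" for \<epsilon>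
      using order_tendstoD(2)[of _ 0 sequentially \<epsilon>] that by (simp add: eventually_sequentially)
    then show ?thesis using \<sigma> f by (simp only: limit_metric_sequentially) blast
  qed
  have "mcomplete"
    unfolding mcomplete_def
  proof (intro allI impI)
    fix \<sigma> assume MC: "MCauchy \<sigma>"
    from MC[unfolded MCauchy_def] have ran: "range \<sigma> \<subseteq> carrier ?H"
      by (rule conjunct1)
    from MC[unfolded MCauchy_def]
    have cau: "\<forall>\<epsilon>>0. \<exists>n0. \<forall>n n'. n0 \<le> n \<longrightarrow> n0 \<le> n' \<longrightarrow> hdist ?H (\<sigma> n) (\<sigma> n') < \<epsilon>"
      by (rule conjunct2)
    have \<sigma>: "\<sigma> n \<in> carrier ?H" for n using ran by (rule range_subsetD)
    have "Cauchy (\<lambda>n. \<sigma> n i)" for i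
    proof (rule metric_CauchyI)
      fix \<epsilon> :: real assume "\<epsilon> > 0"
      then obtain n0 where "\<forall>n n'. n0 \<le> n \<longrightarrow> n0 \<le> n' \<longrightarrow> hdist ?H (\<sigma> n) (\<sigma> n') < \<epsilon>"
        using cau by blast
      then show "\<exists>n0. \<forall>n\<ge>n0. \<forall>n'\<ge>n0. dist (\<sigma> n i) (\<sigma> n' i) < \<epsilon>"
        unfolding dist_norm by (intro exI[of _ n0] allI impI le_less_trans[OF cmod_le_hdist_coord_space[OF \<sigma> \<sigma>]]) blast
    qed
    then have conv: "convergent (\<lambda>n. \<sigma> n i)" for i by (intro Cauchy_convergent)
    define f where "f i = Topological_Spaces.lim (\<lambda>n. \<sigma> n i)" for i
    have f: "(\<lambda>n. \<sigma> n i) \<longlonglongrightarrow> f i" for i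
      using conv unfolding f_def by (rule convergent_LIMSEQ_iff[THEN iffD1])
    have "f i = 0" if "i \<ge> N" for i
    proof -
      have "(\<lambda>n. \<sigma> n i) = (\<lambda>n. 0)" using \<sigma> that by simp
      then show ?thesis using f[of i] by (simp add: LIMSEQ_const_iff)
    qed
    then have "f \<in> carrier ?H" by simp
    then show "\<exists>f. limitin mtopology \<sigma> f sequentially" using lim \<sigma> f by blast
  qed
  moreover have "separable_space mtopology"
  proof -
    obtain D :: "complex set" where D: "countable D" "\<And>X. open X \<Longrightarrow> X \<noteq> {} \<Longrightarrow> \<exists>d\<in>D. d \<in> X"
      by (erule countable_dense_setE)
    define C where "C = (\<lambda>f i. if i < N then f i else 0) ` (\<Pi>\<^sub>E i\<in>{..<N}. D)"
    have "countable C" unfolding C_def by (intro countable_image countable_PiE D(1)) simp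
    moreover have C_sub: "C \<subseteq> carrier ?H" unfolding C_def by (simp add: image_subset_iff)
    moreover have "\<exists>g\<in>C. g \<in> mball f r" if f: "f \<in> carrier ?H" and "r > 0" for f r
    proof -
      \<comment> \<open>With \<open>N + 1\<close> in the denominator the \<open>N\<close> coordinate
        errors add up to strictly less than \<open>r\<close>, and \<open>N = 0\<close> needs no
        separate case.\<close>
      have "r / (N + 1) > 0" using \<open>r > 0\<close> by simp
      then have "\<forall>i. \<exists>d. d \<in> D \<and> cmod (f i - d) < r / (N + 1)"
        using D(2)[of "ball (f _) (r / (N + 1))"] by (simp add: dist_norm Bex_def)
      from choice[OF this]
      obtain h where h: "\<And>i. h i \<in> D" "\<And>i. cmod (f i - h i) < r / (N + 1)" by blast
      define g where "g i = (if i < N then h i else 0)" for i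
      have "restrict h {..<N} \<in> {..<N} \<rightarrow>\<^sub>E D" using h(1) by auto
      moreover have "g = (\<lambda>i. if i < N then restrict h {..<N} i else 0)" by (auto simp: g_def)
      ultimately have "g \<in> C" unfolding C_def by - (rule image_eqI)
      then have g: "g \<in> carrier ?H" by (rule subsetD[OF C_sub])
      have "hdist ?H f g \<le> N * (r / (N + 1))"
        using f g h(2) by (intro hdist_coord_space_le) (simp_all add: g_def less_imp_le)
      also have "\<dots> < r" using \<open>r > 0\<close> by (simp add: field_simps)
      finally have "g \<in> mball f r" using f g by (simp only: in_mball simp_thms)
      then show ?thesis using \<open>g \<in> C\<close> by (rule rev_bexI[rotated])
    qed
    ultimately show ?thesis
      unfolding separable_space_def
      by (intro exI[of _ C]) (simp only: metric_closure_of topspace_mtopology, blast)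
  qed
  ultimately show ?thesis
    unfolding separable_hilbert_space_def separable_hilbert_space_axioms_def
    using complex_inner_space_coord_space by blast
qed

section \<open>Diagonal unitaries and their powers\<close>

lemma unitary_op_diagonal:
  assumes "\<And>i. cmod (a i) = 1"
  shows "unitary_op (coord_space N) (\<lambda>f i. a i * f i)"
proof -
  have [simp]: "a i \<noteq> 0" for i using assms[of i] by auto
  have [simp]: "a i * cnj (a i) = 1" for i
    using assms[of i] by (simp add: complex_norm_square[symmetric])
  have "f \<in> (\<lambda>f i. a i * f i) ` carrier (coord_space N)" if "f \<in> carrier (coord_space N)" for f
    using that by (intro image_eqI[of _ _ "\<lambda>i. f i / a i"]) auto
  moreover have "(\<Sum>i<N. a i * f i * (cnj (a i) * cnj (g i))) = (\<Sum>i<N. f i * cnj (g i))"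
    for f g :: "nat \<Rightarrow> complex"
  proof (rule sum.cong)
    fix i
    have "a i * f i * (cnj (a i) * cnj (g i)) = (a i * cnj (a i)) * (f i * cnj (g i))"
      by (simp only: mult_ac)
    then show "a i * f i * (cnj (a i) * cnj (g i)) = f i * cnj (g i)" by simp
  qed simp
  ultimately show ?thesis
    unfolding unitary_op_def by (auto simp: algebra_simps)
qed

lemma op_powi_diagonal:
  assumes a: "\<And>i. a i \<noteq> 0" and f: "f \<in> carrier (coord_space N)"
  shows "op_powi (coord_space N) (\<lambda>f i. a i * f i) n f = (\<lambda>i. a i powi n * f i)"
proof (cases "n \<ge> 0")
  case True
  have "((\<lambda>f i. a i * f i) ^^ k) f = (\<lambda>i. a i ^ k * f i)" for k
    by (induction k) (auto simp: mult_ac)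
  then show ?thesis using True by (simp add: op_powi_def power_int_def)
next
  case False
  have inj: "inj_on (\<lambda>f i. a i * f i) (carrier (coord_space N))"
    using a by (auto simp: inj_on_def fun_eq_iff)
  \<comment> \<open>The inverse is known only on the carrier, so the induction below must check that
    the iterates stay there.\<close>
  have inv: "inv_into (carrier (coord_space N)) (\<lambda>f i. a i * f i) g = (\<lambda>i. inverse (a i) * g i)"
    if "g \<in> carrier (coord_space N)" for g
    using that a by (intro inv_into_f_eq inj) auto
  have "(inv_into (carrier (coord_space N)) (\<lambda>f i. a i * f i) ^^ k) f = (\<lambda>i. inverse (a i) ^ k * f i)" for k
  proof (induction k)
    case (Suc k)
    have "(\<lambda>i. inverse (a i) ^ k * f i) \<in> carrier (coord_space N)" using f by simp
    from inv[OF this] show ?case using Suc by (simp add: mult.assoc del: coord_space_simps)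
  qed auto
  then show ?thesis using False by (simp add: op_powi_def power_int_def)
qed

section \<open>Products of two integer sequences\<close>

lemma (in quarter_sequence) t_less_1: "t j < 1"
proof -
  have "t j \<le> t 0 * (1/4) ^ j" using geometric_bound[of j 0] by simp
  also have "\<dots> \<le> t 0 * 1" using pos[of 0] by (intro mult_left_mono power_le_one) auto
  finally show ?thesis using first by simp
qed

text \<open>The gliding hump is applied to the maximal deviation over a row, which encodes
  uniformity in \<open>k' \<le> \<psi> k\<close> by a single number per row. Density of
  \<open>C_set m n \<psi>\<close> supplies arbitrarily small admissible angles.\<close>

lemma ex_sparse_angles:
  fixes m n :: "nat \<Rightarrow> int" and \<psi> :: "nat \<Rightarrow> nat"
  assumes dense: "unit_circle \<subseteq> closure (C_set m n \<psi>)" and "0 < \<eta>"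
  obtains t :: "nat \<Rightarrow> real" and J :: "nat \<Rightarrow> nat"
  where "quarter_sequence t" "filterlim J at_top at_top"
    and "\<And>k k' i. k' \<le> \<psi> k \<Longrightarrow> i \<noteq> J k \<Longrightarrow>
      cmod (cis (real_of_int (m k * n k') * t i) - 1) \<le> \<eta> * (1/2) ^ i * (1/2) ^ J k"
proof -
  define d where "d k k' s = cmod (cis (real_of_int (m k * n k') * s) - 1)" for k k' s
  define D where "D s k = (MAX k'\<in>{..\<psi> k}. d k k' s)" for s k
  have d_le_D: "d k k' s \<le> D s k" if "k' \<le> \<psi> k" for k k' s
    unfolding D_def using that by (intro Max_ge) auto
  have D_nonneg: "0 \<le> D s k" for s k
    using d_le_D[of 0 k s] by (simp add: d_def order_trans[OF norm_ge_zero])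
  have lim: "D s \<longlonglongrightarrow> 0" if "s \<in> {s. cis s \<in> C_set m n \<psi>}" for s
  proof (rule LIMSEQ_I)
    fix r :: real assume "r > 0"
    moreover have "tendsto_along \<psi> (\<lambda>k k'. cis (real_of_int (m k * n k') * s)) 1"
      using that by (simp add: C_set_def cis_power_int)
    ultimately obtain k0 where "\<forall>(k, k')\<in>D_set \<psi>. k0 \<le> k \<longrightarrow> d k k' s < r"
      unfolding tendsto_along_def d_def by blast
    then have k0: "d k k' s < r" if "k0 \<le> k" "k' \<le> \<psi> k" for k k'
      using that by (auto simp: D_set_def)
    have "D s k < r" if "k0 \<le> k" for k
      unfolding D_def using k0[OF that] by (subst Max_less_iff) auto
    then show "\<exists>k0. \<forall>k\<ge>k0. norm (D s k - 0) < r" using D_nonneg by auto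
  qed
  \<comment> \<open>A row is finite, so its maximum is squeezed by a finite sum of continuous
    functions that vanish at angle \<open>0\<close>.\<close>
  have lim0: "((\<lambda>s. D s k) \<longlongrightarrow> 0) (at_right 0)" for k
  proof (rule tendsto_sandwich[where f = "\<lambda>_. 0" and h = "\<lambda>s. \<Sum>k'\<le>\<psi> k. d k k' s"])
    have "D s k \<le> (\<Sum>k'\<le>\<psi> k. d k k' s)" for s
      unfolding D_def by (subst Max_le_iff) (auto intro!: member_le_sum simp: d_def)
    then show "\<forall>\<^sub>F s in at_right 0. D s k \<le> (\<Sum>k'\<le>\<psi> k. d k k' s)" by simp
    have "((\<lambda>s. \<Sum>k'\<le>\<psi> k. d k k' s) \<longlongrightarrow> (\<Sum>k'\<le>\<psi> k. d k k' 0)) (at_right 0)"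
      unfolding d_def cis_conv_exp by (intro tendsto_intros)
    then show "((\<lambda>s. \<Sum>k'\<le>\<psi> k. d k k' s) \<longlongrightarrow> 0) (at_right 0)" by (simp add: d_def)
  qed (simp_all add: D_nonneg)
  have "\<exists>s. 0 < s \<and> s < \<delta> \<and> s \<in> {s. cis s \<in> C_set m n \<psi>}" if "0 < \<delta>" for \<delta>
  proof -
    have "C_set m n \<psi> \<subseteq> unit_circle" by (auto simp: C_set_def)
    from exists_small_arg[OF dense this that] show ?thesis by simp
  qed
  from sparse_sequence[OF this lim lim0 \<open>0 < \<eta>\<close>]
  obtain t J where "\<And>j. 0 < t j" "t 0 < 1" "\<And>j. t (Suc j) \<le> t j / 4" "filterlim J at_top at_top"
    and "\<And>k i. i \<noteq> J k \<Longrightarrow> D (t i) k \<le> \<eta> * (1/2) ^ i * (1/2) ^ J k" by metis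
  then show thesis
    using d_le_D that[of t J] unfolding d_def by (meson order_trans quarter_sequence.intro)
qed

section \<open>The measure and the failure of the Kazhdan property\<close>

lemma cmod_cis_minus_1_le: "cmod (cis x - 1) \<le> 2"
  using norm_triangle_ineq4[of "cis x" 1] by simp

text \<open>In row \<open>k\<close> the index \<open>J k\<close> costs at most
  \<open>2 * p (J k)\<close> and the others together at most a geometric series. The total
  \<open>\<beta> (J k)\<close> is small through \<open>\<eta>\<close> and tends to \<open>0\<close>
  because \<open>J\<close> tends to infinity.\<close>

lemma ex_continuous_measure:
  assumes dense: "unit_circle \<subseteq> closure (C_set m n \<psi>)" and "0 < \<epsilon>"
  shows "\<exists>\<mu>. circle_probability \<mu> \<and> continuous_measure \<mu> \<and>
    tendsto_along \<psi> (\<lambda>k k'. fourier_coeff \<mu> (m k * n k')) 1 \<and>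
    (SUP (k, k') \<in> D_set \<psi>. cmod (fourier_coeff \<mu> (m k * n k') - 1)) < \<epsilon>"
proof -
  \<comment> \<open>The value \<open>1/2\<close> serves the condition on \<open>p\<close> in
    \<open>ex_bernoulli_measure\<close>; \<open>\<epsilon> / 8\<close> gives
    \<open>\<beta> j \<le> 4 * \<eta> \<le> \<epsilon> / 2\<close>.\<close>
  define \<eta> where "\<eta> = min (1/2) (\<epsilon> / 8)"
  have \<eta>: "0 < \<eta>" "\<eta> \<le> 1/2" "\<eta> \<le> \<epsilon> / 8" using \<open>0 < \<epsilon>\<close> by (auto simp: \<eta>_def)
  obtain t J where t: "quarter_sequence t" and J: "filterlim J at_top at_top"
    and d: "\<And>k k' i. k' \<le> \<psi> k \<Longrightarrow> i \<noteq> J k \<Longrightarrow>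
      cmod (cis (real_of_int (m k * n k') * t i) - 1) \<le> \<eta> * (1/2) ^ i * (1/2) ^ J k"
    using ex_sparse_angles[OF dense \<eta>(1)] by metis
  interpret quarter_sequence t by (rule t)
  \<comment> \<open>Harmonic weights tend to \<open>0\<close>, as convergence of the coefficients
    requires, but have a divergent sum, as the absence of atoms requires.\<close>
  define p where "p i = \<eta> / real (Suc i)" for i
  have p: "0 \<le> p i" "p i \<le> \<eta>" for i
    using \<eta>(1) by (auto simp: p_def divide_le_eq)
  have "\<not> summable (\<lambda>i. inverse (real (Suc i)))"
    using not_summable_harmonic[where 'a = real] summable_Suc_iff[of "\<lambda>i. inverse (real i)"] by simp
  then have "\<not> summable (\<lambda>i. \<eta> * inverse (real (Suc i)))"
    using \<eta>(1) by (subst summable_cmult_iff) simp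
  then have "\<not> summable p" by (simp only: p_def[abs_def] divide_inverse not_False_eq_True)
  then obtain \<mu> where \<mu>: "circle_probability \<mu>" "continuous_measure \<mu>"
    and F: "\<And>N. cmod (fourier_coeff \<mu> N - 1) \<le> (\<Sum>j. p j * cmod (cis (N * t j) - 1))"
    using ex_bernoulli_measure[of p] p \<eta>(2) by (meson order_trans)
  define \<beta> where "\<beta> j = 2 * p j + \<eta> * (1/2) ^ j * 2" for j
  have bound: "cmod (fourier_coeff \<mu> (m k * n k') - 1) \<le> \<beta> (J k)" if "k' \<le> \<psi> k" for k k'
  proof -
    let ?d = "\<lambda>j. cmod (cis (real_of_int (m k * n k') * t j) - 1)"
    let ?g = "\<lambda>j. (if j = J k then 2 * p j else 0) + \<eta> * (1/2) ^ J k * (1/2) ^ j"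
    have g: "?g sums \<beta> (J k)"
      unfolding \<beta>_def using geometric_sums[of "1/2 :: real"]
      by (intro sums_add sums_single sums_mult) simp
    have le: "p j * ?d j \<le> ?g j" for j
    proof (cases "j = J k")
      case True
      have "p j * ?d j \<le> p j * 2" by (intro mult_left_mono cmod_cis_minus_1_le p)
      moreover have "0 \<le> \<eta> * (1/2) ^ J k * (1/2) ^ j" using \<eta>(1) by simp
      ultimately show ?thesis using True by simp
    next
      case False
      have "p j * ?d j \<le> 1 * ?d j" using p[of j] \<eta>(2) by (intro mult_right_mono) auto
      then show ?thesis using d[OF that False] False by (simp add: mult_ac)
    qed
    have sm: "summable (\<lambda>j. p j * ?d j)"
      using le p by (intro summable_comparison_test'[OF sums_summable[OF g], where N = 0]) simp
    have "(\<Sum>j. p j * ?d j) \<le> \<beta> (J k)"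
      using suminf_le[OF le sm sums_summable[OF g]] sums_unique[OF g] by simp
    then show ?thesis using F[of "m k * n k'"] by linarith
  qed
  have "p \<longlonglongrightarrow> 0"
    unfolding p_def by (rule LIMSEQ_Suc[OF lim_const_over_n])
  then have "\<beta> \<longlonglongrightarrow> 2 * 0 + \<eta> * 0 * 2"
    unfolding \<beta>_def by (intro tendsto_intros LIMSEQ_realpow_zero) auto
  then have lim: "(\<lambda>k. \<beta> (J k)) \<longlonglongrightarrow> 0"
    using filterlim_compose[OF _ J] by simp
  have "tendsto_along \<psi> (\<lambda>k k'. fourier_coeff \<mu> (m k * n k')) 1"
    unfolding tendsto_along_def
  proof (intro allI impI)
    fix \<gamma> :: real assume "\<gamma> > 0"
    then obtain k0 where "\<And>k. k0 \<le> k \<Longrightarrow> \<beta> (J k) < \<gamma>"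
      using order_tendstoD(2)[OF lim] by (auto simp: eventually_sequentially)
    then show "\<exists>k0. \<forall>(k, k')\<in>D_set \<psi>. k0 \<le> k \<longrightarrow> cmod (fourier_coeff \<mu> (m k * n k') - 1) < \<gamma>"
      using bound by (intro exI[of _ k0]) (auto simp: D_set_def intro: le_less_trans)
  qed
  moreover have \<beta>_le: "\<beta> j \<le> \<epsilon> / 2" for j
  proof -
    have "\<eta> * (1/2) ^ j \<le> \<eta>" using \<eta>(1) by (simp add: mult_left_le power_le_one)
    then show ?thesis using p(2)[of j] \<eta>(3) by (simp add: \<beta>_def)
  qed
  \<comment> \<open>Half of \<open>\<epsilon>\<close> leaves room for a strict inequality after the
    supremum is taken.\<close>
  have "(SUP (k, k') \<in> D_set \<psi>. cmod (fourier_coeff \<mu> (m k * n k') - 1)) \<le> \<epsilon> / 2"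
    using order_trans[OF bound \<beta>_le]
    by (intro cSUP_least) (auto simp: D_set_def simp del: le_divide_eq_numeral1)
  ultimately show ?thesis using \<mu> \<open>0 < \<epsilon>\<close> by (intro exI[of _ \<mu>]) auto
qed

text \<open>For the diagonal unitary with eigenvalues \<open>cis (t i)\<close>,
  \<open>i < N\<close>, the unit vector with equal coordinates has as squared displacement the mean
  of the squared deviations, at most \<open>6 / N\<close>, while no eigenvalue is
  \<open>1\<close>.\<close>

lemma not_kazhdan_subset_products:
  assumes dense: "unit_circle \<subseteq> closure (C_set m n \<psi>)"
  shows "\<not> kazhdan_subset {m k * n k' | k k'. 0 \<le> k' \<and> k' \<le> \<psi> k}"
    (is "\<not> kazhdan_subset ?Q")
proof
  assume "kazhdan_subset ?Q"
  then obtain \<epsilon> where "\<epsilon> > 0"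
    and K: "\<And>H :: (nat \<Rightarrow> complex) inner_module. separable_hilbert_space H \<Longrightarrow> kazhdan_property H ?Q \<epsilon>"
    by (auto simp: kazhdan_subset_def)
  obtain t J where t: "quarter_sequence t"
    and d: "\<And>k k' i. k' \<le> \<psi> k \<Longrightarrow> i \<noteq> J k \<Longrightarrow>
      cmod (cis (real_of_int (m k * n k') * t i) - 1) \<le> 1 * (1/2) ^ i * (1/2) ^ J k"
    using ex_sparse_angles[OF dense zero_less_one] by metis
  interpret quarter_sequence t by (rule t)
  \<comment> \<open>Here \<open>6 = 4 + 2\<close>: the index \<open>J k\<close> contributes at most
    the square of \<open>2\<close>, the others at most the geometric series with sum
    \<open>2\<close>. The displacement \<open>sqrt (6 / N)\<close> is thus at most
    \<open>\<epsilon> / 2\<close>.\<close>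
  obtain N :: nat where N: "6 / (\<epsilon> / 2)\<^sup>2 < real N" using reals_Archimedean2 by blast
  have "0 < 6 / (\<epsilon> / 2)\<^sup>2" using \<open>\<epsilon> > 0\<close> by simp
  then have "0 < real N" using N by linarith
  then have N': "6 / real N \<le> (\<epsilon> / 2)\<^sup>2" using N \<open>\<epsilon> > 0\<close> by (simp add: field_simps)
  define U where "U = (\<lambda>f i. cis (t i) * f i)"
  define x where "x i = (if i < N then complex_of_real (1 / sqrt N) else 0)" for i
  have x: "x \<in> carrier (coord_space N)" by (simp add: x_def)
  have U: "unitary_op (coord_space N) U" unfolding U_def by (rule unitary_op_diagonal) simp
  have pw: "op_powi (coord_space N) U q x = (\<lambda>i. cis (real_of_int q * t i) * x i)" for q
    unfolding U_def by (subst op_powi_diagonal[OF _ x]) (auto simp: cis_power_int)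
  have "hdist (coord_space N) (op_powi (coord_space N) U q x) x \<le> \<epsilon> / 2" if qQ: "q \<in> ?Q" for q
  proof -
    obtain k k' where q: "q = m k * n k'" "k' \<le> \<psi> k" using qQ by auto
    let ?d = "\<lambda>i. cmod (cis (real_of_int q * t i) - 1)"
    have "(cmod (cis (real_of_int q * t i) * x i - x i))\<^sup>2 = (?d i)\<^sup>2 / N" if "i < N" for i
    proof -
      have "cis (real_of_int q * t i) * x i - x i = (cis (real_of_int q * t i) - 1) * x i"
        by (simp add: algebra_simps)
      then show ?thesis using that \<open>0 < real N\<close>
        by (simp add: norm_mult power_mult_distrib x_def norm_divide power_divide)
    qed
    moreover have "op_powi (coord_space N) U q x \<in> carrier (coord_space N)"
      unfolding pw by (simp add: x_def)
    ultimately have "hdist (coord_space N) (op_powi (coord_space N) U q x) x = sqrt ((\<Sum>i<N. (?d i)\<^sup>2) / N)"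
      by (simp add: hdist_coord_space[OF _ x] pw sum_divide_distrib)
    moreover have "(\<Sum>i<N. (?d i)\<^sup>2) \<le> 6"
    proof -
      have "(?d i)\<^sup>2 \<le> (if i = J k then 4 else 0) + (1/2) ^ i" for i
      proof (cases "i = J k")
        case True
        have "(?d i)\<^sup>2 \<le> 2\<^sup>2" by (intro power_mono cmod_cis_minus_1_le) simp
        then show ?thesis using True by (simp add: add_increasing2)
      next
        case False
        have "?d i \<le> (1/2) ^ i * (1/2) ^ J k" using d[OF q(2) False] q(1) by simp
        also have "\<dots> \<le> (1/2) ^ i" by (simp add: mult_left_le power_le_one)
        finally have "?d i \<le> (1/2) ^ i" .
        \<comment> \<open>One factor keeps the geometric decay, the other is bounded by
          \<open>1\<close>.\<close>
        then have "?d i * ?d i \<le> (1/2) ^ i * 1"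
          using power_le_one[of "1/2 :: real" i] by (intro mult_mono) auto
        then show ?thesis using False by (simp add: power2_eq_square)
      qed
      then have "(\<Sum>i<N. (?d i)\<^sup>2) \<le> (\<Sum>i<N. (if i = J k then 4 else 0) + (1/2) ^ i)"
        by (rule sum_mono)
      also have "\<dots> \<le> 4 + (\<Sum>i. (1/2) ^ i)"
        unfolding sum.distrib by (intro add_mono sum_le_suminf) (auto simp: sum.delta)
      finally show ?thesis by (simp add: suminf_geometric)
    qed
    then have "(\<Sum>i<N. (?d i)\<^sup>2) / N \<le> (\<epsilon> / 2)\<^sup>2"
      using N' \<open>0 < real N\<close> by (meson divide_right_mono less_imp_le order_trans)
    then have "sqrt ((\<Sum>i<N. (?d i)\<^sup>2) / N) \<le> \<epsilon> / 2"
      using \<open>\<epsilon> > 0\<close> by (intro real_le_lsqrt) auto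
    ultimately show ?thesis by simp
  qed
  then have "(SUP q\<in>?Q. ereal (hdist (coord_space N) (op_powi (coord_space N) U q x) x)) \<le> ereal (\<epsilon> / 2)"
    by (intro SUP_least) simp
  also have "\<dots> < ereal \<epsilon>" using \<open>\<epsilon> > 0\<close> by simp
  finally have sup: "(SUP q\<in>?Q. ereal (hdist (coord_space N) (op_powi (coord_space N) U q x) x)) < ereal \<epsilon>" .
  have "hnorm (coord_space N) x = 1"
    using \<open>0 < real N\<close> by (simp add: hnorm_coord_space x_def norm_divide power_divide)
  then obtain y where y: "y \<in> carrier (coord_space N)" "y \<noteq> \<zero>\<^bsub>coord_space N\<^esub>" "U y = y"
    using K[OF separable_hilbert_space_coord_space] U x sup unfolding kazhdan_property_def by blast
  then obtain i where "y i \<noteq> 0" by (auto simp: fun_eq_iff)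
  \<comment> \<open>A nonzero coordinate of a fixed vector forces its eigenvalue to be
    \<open>1\<close>, whereas \<open>0 < t i < 1\<close> makes the sine positive.\<close>
  then have "cis (t i) = 1" using fun_cong[OF y(3), of i] by (simp add: U_def)
  then have "sin (t i) = 0" by (metis cis.sel(2) one_complex.sel(2))
  then show False using sin_gt_zero[of "t i"] pos[of i] t_less_1[of i] pi_gt3 by simp
qed

theorem theorem2p4:
  fixes m n :: "nat \<Rightarrow> int" and \<psi> :: "nat \<Rightarrow> nat"
  assumes "strict_mono m" and "strict_mono n"
    and "filterlim \<psi> at_top at_top"
    and "unit_circle \<subseteq> closure (C_set m n \<psi>)"
  shows "(\<forall>\<epsilon>>0. \<exists>\<mu>. circle_probability \<mu> \<and> continuous_measure \<mu> \<and>
            tendsto_along \<psi> (\<lambda>k k'. fourier_coeff \<mu> (m k * n k')) 1 \<and>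
            (SUP (k, k') \<in> D_set \<psi>. cmod (fourier_coeff \<mu> (m k * n k') - 1)) < \<epsilon>)
       \<and> \<not> kazhdan_subset {m k * n k' | k k'. 0 \<le> k' \<and> k' \<le> \<psi> k}"
  using ex_continuous_measure[OF assms(4)] not_kazhdan_subset_products[OF assms(4)] by blast

end
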